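(* Let $K\subset\mathbb{R}^d$ be an open convex body in canonical form. Let $\delta\in(0,1/2]$ be sufficiently small such that $K_\delta\neq\emptyset$. Then there exists a point $x_\delta\in K_\delta$ such that $$K_\delta\subset B_K\left(x_\delta,\ \frac12\ln\frac1\delta+24d^3\right).$$ Specifically, $x_\delta$ can be chosen as the origin $o$ when $o\in K_\delta$, and as any point of $K_\delta$ when $o\notin K_\delta$.
   Context: An open convex body is a nonempty, bounded, open convex subset of $\mathbb{R}^d$. $K$ is in canonical form if its inner John ellipsoid (the open ellipsoid of maximal volume contained in $K$) is the open Euclidean ball of radius $1/(2d)$ centered at the origin $o$. The $\delta$-depth-trimmed region of $K$ is $K_\delta=\{q\in\mathbb{R}^d: D_K(q)\ge\delta\}$, where $D_K(q)=\inf\{|\{z\in K:\langle v,z-q\rangle\ge0\}|/|K| : v\in\mathbb{R}^d,\ \|v\|=1\}$ is the halfspace depth and $|\cdot|$ is Lebesgue volume. The Hilbert metric on $K$: for distinct $p,q\in K$, let $a,b$ be the points where the line through $p$ and $q$ meets the boundary of $K$, labelled so that $a,p,q,b$ are in consecutive order; then $d_K(p,q)=\frac12\ln\frac{\|q-a\|\,\|p-b\|}{\|p-a\|\,\|q-b\|}$, and $d_K(p,p)=0$. For $x\in K$ and $r>0$, $B_K(x,r)=\{y\in K:d_K(x,y)<r\}$. *)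

theory Defs
  imports "HOL-Analysis.Analysis"
begin

definition open_convex_body :: "(real^'n) set \<Rightarrow> bool" where
  "open_convex_body K \<longleftrightarrow> K \<noteq> {} \<and> bounded K \<and> open K \<and> convex K"

definition open_ellipsoid :: "(real^'n) set \<Rightarrow> bool" where
  "open_ellipsoid E \<longleftrightarrow>
     (\<exists>(A :: real^'n^'n) c. invertible A \<and> E = (\<lambda>x. c + A *v x) ` ball 0 1)"

(* A predicate rather than a function: by John's theorem the ellipsoid of maximal volume
   exists and is unique for every open convex body. *)
definition inner_John_ellipsoid :: "(real^'n) set \<Rightarrow> (real^'n) set \<Rightarrow> bool" where
  "inner_John_ellipsoid K E \<longleftrightarrow> open_ellipsoid E \<and> E \<subseteq> K \<and>
     (\<forall>F. open_ellipsoid F \<and> F \<subseteq> K \<longrightarrow> measure lebesgue F \<le> measure lebesgue E)"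

definition canonical_form :: "(real^'n) set \<Rightarrow> bool" where
  "canonical_form K \<longleftrightarrow> inner_John_ellipsoid K (ball 0 (1 / (2 * real CARD('n))))"

definition halfspace_depth :: "(real^'n) set \<Rightarrow> real^'n \<Rightarrow> real" where
  "halfspace_depth K q =
     (INF v\<in>{v. norm v = 1}. measure lebesgue {z\<in>K. v \<bullet> (z - q) \<ge> 0} / measure lebesgue K)"

definition trimmed_region :: "(real^'n) set \<Rightarrow> real \<Rightarrow> (real^'n) set" where
  "trimmed_region K \<delta> = {q. halfspace_depth K q \<ge> \<delta>}"

(* The boundary point a for which a, p, q are consecutive on the line through p and q;
   the point b beyond q is chord_end K q p. For an open convex body K and distinct p, q in K
   the point exists and is unique. *)
definition chord_end :: "(real^'n) set \<Rightarrow> real^'n \<Rightarrow> real^'n \<Rightarrow> real^'n" where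
  "chord_end K p q = (THE a. a \<in> frontier K \<and> p \<in> open_segment a q)"

definition hilbert_dist :: "(real^'n) set \<Rightarrow> real^'n \<Rightarrow> real^'n \<Rightarrow> real" where
  "hilbert_dist K p q = (if p = q then 0 else
     (let a = chord_end K p q; b = chord_end K q p
      in 1/2 * ln ((norm (q - a) * norm (p - b)) / (norm (p - a) * norm (q - b)))))"

definition hilbert_ball :: "(real^'n) set \<Rightarrow> real^'n \<Rightarrow> real \<Rightarrow> (real^'n) set" where
  "hilbert_ball K x r = {y\<in>K. hilbert_dist K x y < r}"

end

theory Submission
  imports Defs
begin

text \<open>With \<open>d\<close> the dimension and \<open>r = 1 / (2 * d)\<close>, a weak form of John's theorem gives
  \<open>ball 0 r \<subseteq> K \<subseteq> cball 0 M\<close> with \<open>M = 8 ^ d\<close>; the constant \<open>24 * d ^ 3\<close> is generous enough to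
  absorb such exponential losses. If \<open>q\<close> has depth at least \<open>\<delta>\<close> and \<open>y \<notin> K\<close>, then a halfspace
  separating \<open>y\<close> from \<open>K\<close>, moved to \<open>q\<close>, cuts off a slab of width at most \<open>norm (y - q)\<close> and of
  volume at least \<open>\<delta> * vol K\<close>. Hence \<open>K\<close> contains a ball around \<open>q\<close> of radius \<open>\<delta>\<close> times a constant,
  which bounds the Hilbert distance of \<open>q\<close> from any centre well inside \<open>K\<close>. The origin is such a
  centre. It has depth bounded below as \<open>K\<close> contains half of \<open>ball 0 r\<close> on each side, so if it
  is not in the trimmed region, then \<open>\<delta>\<close> is bounded below and every point of the
  region is such a centre.

  Volumes are estimated by packing disjoint translates, because the library has the linear
  change of variables only for wellordered index types.\<close>

section \<open>Volume estimates from cubes and disjoint translates\<close>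

lemma lmeasurable_cap:
  fixes K :: "(real^'n) set"
  assumes "bounded K" "open K"
  shows "{z\<in>K. v \<bullet> (z - q) \<ge> 0} \<in> lmeasurable"
proof -
  have "{z\<in>K. v \<bullet> (z - q) \<ge> 0} = K \<inter> {z. v \<bullet> z \<ge> v \<bullet> q}"
    by (auto simp: inner_diff_right)
  moreover have "K \<inter> {z. v \<bullet> z \<ge> v \<bullet> q} \<in> lmeasurable"
    using assms by (intro fmeasurable_Int_fmeasurable lmeasurable_open)
      (auto intro!: sets_completionI_sets borel_closed closed_halfspace_ge)
  ultimately show ?thesis by simp
qed

lemma measure_cube:
  assumes "0 \<le> s"
  shows "measure lebesgue (cbox (\<chi> i. - s) (\<chi> i. s) :: (real^'n) set) = (2 * s) ^ CARD('n)"
proof -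
  have "cbox (\<chi> i. - s) (\<chi> i. s) \<noteq> ({} :: (real^'n) set)"
    using assms by (auto simp: interval_ne_empty_cart)
  then show ?thesis
    by (simp add: content_cbox_cart)
qed

lemma measure_cball_le:
  assumes "0 \<le> r"
  shows "measure lebesgue (cball (0 :: real^'n) r) \<le> (2 * r) ^ CARD('n)"
proof -
  have "cball 0 r \<subseteq> (cbox (\<chi> i. - r) (\<chi> i. r) :: (real^'n) set)"
  proof
    fix x :: "real^'n" assume "x \<in> cball 0 r"
    then have "\<bar>x $ i\<bar> \<le> r" for i
      using component_le_norm_cart[of x i] by simp
    then show "x \<in> cbox (\<chi> i. - r) (\<chi> i. r)"
      by (simp add: mem_box_cart abs_le_iff minus_le_iff)
  qed
  then have "measure lebesgue (cball (0 :: real^'n) r) \<le> measure lebesgue (cbox (\<chi> i. - r) (\<chi> i. r) :: (real^'n) set)"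
    by (intro measure_mono_fmeasurable) auto
  then show ?thesis
    using measure_cube[OF assms, where ?'n = 'n] by simp
qed

text \<open>The Euclidean norm is at most the sum of the absolute coordinates, so the cube of half
  side \<open>r / CARD('n)\<close> fits into the closed ball, which has the same volume as the open
  one.\<close>

lemma measure_ball_ge:
  assumes "0 < r"
  shows "(2 * (r / CARD('n))) ^ CARD('n) \<le> measure lebesgue (ball (0 :: real^'n) r)"
proof -
  define s where "s = r / CARD('n)"
  have s: "0 \<le> s" "CARD('n) * s = r"
    using assms by (auto simp: s_def)
  have "(cbox (\<chi> i. - s) (\<chi> i. s) :: (real^'n) set) \<subseteq> cball 0 r"
  proof
    fix x :: "real^'n" assume x: "x \<in> cbox (\<chi> i. - s) (\<chi> i. s)"
    have "norm x \<le> (\<Sum>i\<in>UNIV. \<bar>x $ i\<bar>)"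
      by (rule norm_le_l1_cart)
    also have "\<dots> \<le> (\<Sum>i\<in>(UNIV :: 'n set). s)"
      using x by (intro sum_mono) (auto simp: mem_box_cart abs_le_iff minus_le_iff)
    finally show "x \<in> cball 0 r"
      using s by simp
  qed
  then have "measure lebesgue (cbox (\<chi> i. - s) (\<chi> i. s) :: (real^'n) set) \<le> measure lebesgue (cball (0 :: real^'n) r)"
    by (intro measure_mono_fmeasurable) auto
  then show ?thesis
    using measure_cube[OF s(1), where ?'n = 'n] assms by (simp add: s_def content_cball content_ball)
qed

text \<open>By \<open>sep\<close> the set \<open>S\<close> is thinner in direction \<open>v\<close>
  than the shift \<open>u\<close> is long, so the translates by multiples of \<open>u\<close> are
  pairwise disjoint, and \<open>N\<close> of them lie in \<open>T\<close>.\<close>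

lemma measure_packing_le:
  fixes S T :: "'a::euclidean_space set"
  assumes S: "S \<in> lmeasurable" and T: "T \<in> lmeasurable"
    and sep: "\<And>x y. x \<in> S \<Longrightarrow> y \<in> S \<Longrightarrow> v \<bullet> (x - y) < v \<bullet> u"
    and sub: "\<And>j x. j < N \<Longrightarrow> x \<in> S \<Longrightarrow> real j *\<^sub>R u + x \<in> T"
  shows "real N * measure lebesgue S \<le> measure lebesgue T"
proof -
  define t where "t = (\<lambda>j. (+) (real j *\<^sub>R u) ` S)"
  have disj: "t i \<inter> t j = {}" if "i < j" for i j
  proof (rule ccontr)
    assume "t i \<inter> t j \<noteq> {}"
    then obtain x y where xy: "x \<in> S" "y \<in> S" "real i *\<^sub>R u + x = real j *\<^sub>R u + y"
      by (auto simp: t_def)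
    then have "x - y = real (j - i) *\<^sub>R u"
      using that by (simp add: of_nat_diff algebra_simps)
    with sep[OF xy(1,2)] have less: "real (j - i) * (v \<bullet> u) < v \<bullet> u"
      by simp
    moreover have "0 < v \<bullet> u"
      using sep[OF xy(1,1)] by simp
    ultimately show False
      using that by (simp add: mult_less_cancel_right1)
  qed
  have "disjoint_family_on t {..<N}"
    unfolding disjoint_family_on_def using disj by (metis Int_commute linorder_neqE_nat)
  moreover have tm: "t j \<in> lmeasurable" for j
    unfolding t_def using S by (rule measurable_translation)
  ultimately have "measure lebesgue (\<Union>j<N. t j) = (\<Sum>j<N. measure lebesgue (t j))"
    by (intro measure_UNION') (auto simp: disjoint_family_on_def pairwise_def disjnt_def)
  also have "\<dots> = real N * measure lebesgue S"
    by (simp add: t_def measure_translation)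
  finally have "real N * measure lebesgue S = measure lebesgue (\<Union>j<N. t j)" ..
  also have "\<dots> \<le> measure lebesgue T"
    using T tm sub by (intro measure_mono_fmeasurable fmeasurableD sets.finite_UN) (auto simp: t_def)
  finally show ?thesis .
qed

text \<open>About \<open>M / w\<close> copies of the slab piece can be stacked along
  \<open>v\<close> without leaving the ball of radius \<open>2 * M\<close>, whose volume is at most
  \<open>(4 * M) ^ CARD('n)\<close>.\<close>

lemma measure_slab_le:
  fixes S :: "(real^'n) set"
  assumes S: "S \<in> lmeasurable" "S \<subseteq> cball 0 M" and v: "norm v = 1"
    and slab: "\<And>z. z \<in> S \<Longrightarrow> c \<le> v \<bullet> z \<and> v \<bullet> z \<le> c + w"
    and pos: "0 < M" "0 < w"
  shows "M * measure lebesgue S \<le> 2 * w * (4 * M) ^ CARD('n)"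
proof (cases "w < M")
  case False
  have "measure lebesgue S \<le> measure lebesgue (cball (0 :: real^'n) M)"
    using S by (intro measure_mono_fmeasurable) auto
  also have "\<dots> \<le> (2 * M) ^ CARD('n)"
    using pos by (intro measure_cball_le) auto
  also have "\<dots> \<le> (4 * M) ^ CARD('n)"
    using pos by (intro power_mono) auto
  finally show ?thesis
    using False pos by (intro mult_mono) auto
next
  case True
  \<comment> \<open>The largest integer strictly below \<open>M / w\<close>. Strictness makes the
    shift \<open>M / N\<close> exceed the thickness \<open>w\<close>; since
    \<open>M / w > 1\<close>, also \<open>N \<ge> 1\<close> and
    \<open>M / w \<le> N + 1 \<le> 2 * N\<close>.\<close>
  define N where "N = nat (\<lceil>M / w\<rceil> - 1)"
  have "1 < M / w"
    using True pos by simp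
  then have "real N = real_of_int \<lceil>M / w\<rceil> - 1" "1 < \<lceil>M / w\<rceil>"
    unfolding N_def by (auto simp: less_ceiling_iff)
  moreover have "real_of_int \<lceil>M / w\<rceil> - 1 < M / w" "M / w \<le> real_of_int \<lceil>M / w\<rceil>"
    using ceiling_correct[of "M / w"] by auto
  ultimately have N: "1 \<le> real N" "real N < M / w" "M / w \<le> 2 * real N"
    by linarith+
  define u where "u = (M / real N) *\<^sub>R v"
  have "real N * measure lebesgue S \<le> measure lebesgue (cball (0 :: real^'n) (2 * M))"
  proof (rule measure_packing_le[OF S(1)])
    fix x y assume "x \<in> S" "y \<in> S"
    then have "v \<bullet> (x - y) \<le> w"
      using slab[of x] slab[of y] by (simp add: inner_diff_right)
    also have "w < M / real N"
    proof -
      have "0 < real N"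
        using N by linarith
      then show ?thesis
        using N(2) pos by (simp add: field_simps)
    qed
    also have "\<dots> = v \<bullet> u"
      using v by (simp add: u_def dot_square_norm)
    finally show "v \<bullet> (x - y) < v \<bullet> u" .
  next
    fix j x assume j: "j < N" and x: "x \<in> S"
    have "norm (real j *\<^sub>R u) \<le> M"
      using j pos v by (simp add: u_def field_simps)
    moreover have "norm x \<le> M"
      using x S by auto
    ultimately show "real j *\<^sub>R u + x \<in> cball 0 (2 * M)"
      using norm_triangle_ineq[of "real j *\<^sub>R u" x] by simp
  qed auto
  also have "\<dots> \<le> (4 * M) ^ CARD('n)"
    using measure_cball_le[of "2 * M", where ?'n = 'n] pos by simp
  finally have "2 * w * (real N * measure lebesgue S) \<le> 2 * w * (4 * M) ^ CARD('n)"
    using pos by (intro mult_left_mono) auto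
  moreover have "M * measure lebesgue S \<le> (2 * w * real N) * measure lebesgue S"
    using N pos by (intro mult_right_mono) (auto simp: field_simps)
  ultimately show ?thesis
    by (simp add: mult.assoc)
qed

section \<open>An outer ball from the maximality of the inner ball\<close>

text \<open>A weak form of John's theorem: if \<open>K\<close> contained a point \<open>p\<close> much further away, then stretching
  the ball towards \<open>p\<close> (half axis \<open>norm p / 4\<close>) while halving it in the orthogonal
  directions would give an ellipsoid inside the convex hull of the ball and \<open>p\<close>. It contains
  about \<open>norm p / (2 * r)\<close> disjoint balls of radius \<open>r / 8\<close> with centres on its long axis,
  so its volume would be too large.\<close>

lemma inner_John_ball_subset_cball:
  fixes K :: "(real^'n) set"
  assumes K: "convex K" and r: "0 < r" and John: "inner_John_ellipsoid K (ball 0 r)"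
  shows "K \<subseteq> cball 0 (2 * 8 ^ CARD('n) * r)"
proof
  fix p assume p: "p \<in> K"
  have ballK: "ball 0 r \<subseteq> K"
    using John by (auto simp: inner_John_ellipsoid_def)
  show "p \<in> cball 0 (2 * 8 ^ CARD('n) * r)"
  proof (cases "4 * r \<le> norm p")
    case False
    have "4 * r \<le> 2 * 8 ^ CARD('n) * r"
      using r power_increasing[of 1 "CARD('n)" "8 :: real"] by (simp add: Suc_leI)
    with False have "norm p \<le> 2 * 8 ^ CARD('n) * r"
      by linarith
    then show ?thesis by simp
  next
    case True
    define R e \<alpha> \<beta> where "R = norm p" and "e = p /\<^sub>R R" and "\<alpha> = R / 4" and "\<beta> = r / 2"
    have "p \<noteq> 0"
      using True r by auto
    then have R: "R > 0" and e: "norm e = 1" and pe: "p = R *\<^sub>R e"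
      by (auto simp: R_def e_def)
    have ee: "e \<bullet> e = 1"
      using e by (simp add: dot_square_norm)
    have \<alpha>: "\<alpha> > 0" "r \<le> \<alpha>" and \<beta>: "\<beta> > 0"
      using R r True by (auto simp: \<alpha>_def R_def \<beta>_def)
    \<comment> \<open>\<open>f\<close> scales by \<open>\<alpha>\<close> along \<open>e\<close> and
      by \<open>\<beta>\<close> orthogonally to it; \<open>g\<close> undoes this, so the matrix of
      \<open>f\<close> is invertible.\<close>
    define f where "f = (\<lambda>x. \<alpha> *\<^sub>R (e \<bullet> x) *\<^sub>R e + \<beta> *\<^sub>R (x - (e \<bullet> x) *\<^sub>R e))"
    define g where "g = (\<lambda>x. (1/\<alpha>) *\<^sub>R (e \<bullet> x) *\<^sub>R e + (1/\<beta>) *\<^sub>R (x - (e \<bullet> x) *\<^sub>R e))"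
    have fg: "f (g x) = x" for x
      using \<alpha> \<beta> ee by (simp add: f_def g_def inner_add_right inner_diff_right)
    have "linear f"
      unfolding f_def by (rule linearI) (auto simp: algebra_simps inner_add_right)
    define A where "A = matrix f"
    have A: "A *v x = f x" for x
      unfolding A_def using \<open>linear f\<close> by (simp add: matrix_works)
    have "surj ((*v) A)"
      by (rule surjI[of _ g]) (simp add: A fg)
    then have inv: "invertible A"
      by (simp add: invertible_right_inverse matrix_right_invertible_surjective)
    have proj: "norm (x - (e \<bullet> x) *\<^sub>R e) \<le> norm x" for x
    proof -
      have "(norm (x - (e \<bullet> x) *\<^sub>R e))\<^sup>2 = (norm x)\<^sup>2 - (e \<bullet> x)\<^sup>2"
        unfolding power2_norm_eq_inner power2_eq_square[of "e \<bullet> x"]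
        by (simp add: inner_diff_left inner_diff_right ee inner_commute[of x e])
      also have "\<dots> \<le> (norm x)\<^sup>2" by simp
      finally show ?thesis by (simp add: power2_le_iff_abs_le)
    qed
    have ex: "\<bar>e \<bullet> x\<bar> \<le> norm x" for x
      using Cauchy_Schwarz_ineq2[of e x] e by simp
    define F where "F = (\<lambda>x. \<alpha> *\<^sub>R e + A *v x) ` ball 0 1"
    have "open_ellipsoid F"
      unfolding open_ellipsoid_def F_def using inv by blast
    moreover have "F \<subseteq> K"
      unfolding F_def
    proof clarify
      fix x :: "real^'n" assume "x \<in> ball 0 1"
      then have x: "norm x < 1" by simp
      \<comment> \<open>The point \<open>\<alpha> *\<^sub>R e + A *v x\<close> has
        \<open>e\<close>-component \<open>\<alpha> * (1 + e \<bullet> x) = t * R\<close>, that of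
        \<open>t *\<^sub>R p\<close>. The rest is \<open>(1 - t) *\<^sub>R w\<close> with
        \<open>w\<close> orthogonal to \<open>e\<close>, and \<open>t < 1/2\<close> with
        \<open>\<beta> = r / 2\<close> puts \<open>w\<close> in the ball.\<close>
      define t where "t = (1 + e \<bullet> x) / 4"
      have t: "0 \<le> t" "t < 1/2"
        using ex[of x] x by (auto simp: t_def)
      define x' where "x' = x - (e \<bullet> x) *\<^sub>R e"
      define w where "w = (\<beta> / (1 - t)) *\<^sub>R x'"
      have "norm w = r * (norm x' / (2 * (1 - t)))"
        using r t by (simp add: w_def \<beta>_def)
      also have "\<dots> < r * 1"
        using r t x proj[of x] by (intro mult_strict_left_mono) (auto simp: x'_def divide_less_eq)
      finally have "w \<in> K"
        using ballK by auto
      then have "(1 - t) *\<^sub>R w + t *\<^sub>R p \<in> K"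
        using K p t by (intro convexD) auto
      also have "(1 - t) *\<^sub>R w = \<beta> *\<^sub>R x'"
        using t by (simp add: w_def)
      also have "\<beta> *\<^sub>R x' + t *\<^sub>R p = \<alpha> *\<^sub>R e + A *v x"
        by (simp add: A f_def x'_def pe t_def \<alpha>_def scaleR_add_left add_divide_distrib distrib_left mult.commute)
      finally show "\<alpha> *\<^sub>R e + A *v x \<in> K" .
    qed
    ultimately have F_le: "measure lebesgue F \<le> measure lebesgue (ball (0 :: real^'n) r)"
      using John by (auto simp: inner_John_ellipsoid_def)
    have F_eq: "F = (+) (\<alpha> *\<^sub>R e) ` f ` ball 0 1"
      by (auto simp: F_def A image_image)
    have "F \<in> lmeasurable"
      unfolding F_eq using \<open>linear f\<close>
      by (intro measurable_translation measurable_convex convex_linear_image bounded_linear_image)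
        (auto simp: linear_conv_bounded_linear)
    \<comment> \<open>With \<open>j = 0\<close> included, the last index is the floor, so every
      shift \<open>j * (r / 4)\<close> is at most \<open>R / 8 = \<alpha> / 2\<close>.\<close>
    define N where "N = nat \<lfloor>R / (2 * r)\<rfloor> + 1"
    have N: "real N - 1 \<le> R / (2 * r)" "R / (2 * r) \<le> real N"
      unfolding N_def using R r by (simp_all add: of_nat_floor) linarith
    \<comment> \<open>The balls have radius \<open>r / 8\<close> and are shifted by their diameter
      \<open>r / 4\<close>; being open, they stay disjoint.\<close>
    have "real N * measure lebesgue (ball (\<alpha> *\<^sub>R e) (r / 8)) \<le> measure lebesgue F"
    proof (rule measure_packing_le[where v = e and u = "(r / 4) *\<^sub>R e"])
      fix x y assume "x \<in> ball (\<alpha> *\<^sub>R e) (r / 8)" "y \<in> ball (\<alpha> *\<^sub>R e) (r / 8)"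
      then have "dist x y < r / 4"
        using dist_triangle_half_r[of "\<alpha> *\<^sub>R e" x "r / 4" y] by simp
      then show "e \<bullet> (x - y) < e \<bullet> (r / 4) *\<^sub>R e"
        using ex[of "x - y"] by (simp add: ee dist_norm)
    next
      fix j x assume j: "j < N" and "x \<in> ball (\<alpha> *\<^sub>R e) (r / 8)"
      define y where "y = x - \<alpha> *\<^sub>R e"
      have y: "norm y < r / 8"
        using \<open>x \<in> _\<close> by (simp add: y_def dist_norm norm_minus_commute)
      define s where "s = real j * (r / 4)"
      have s: "0 \<le> s" "s \<le> \<alpha> / 2"
      proof -
        have "s \<le> (R / (2 * r)) * (r / 4)"
          unfolding s_def using j N r by (intro mult_right_mono) linarith+
        then show "s \<le> \<alpha> / 2"
          using r by (simp add: \<alpha>_def)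
      qed (use r in \<open>simp add: s_def\<close>)
      define z where "z = s *\<^sub>R e + y"
      \<comment> \<open>A point of the shifted ball lies in \<open>F\<close> if its preimage is in
        the unit ball. The part along \<open>e\<close> is at most \<open>1/2 + 1/8\<close> because
        \<open>r \<le> \<alpha>\<close>, the orthogonal part at most \<open>1/4\<close>.\<close>
      have "g z = ((s + e \<bullet> y) / \<alpha>) *\<^sub>R e + (1/\<beta>) *\<^sub>R (y - (e \<bullet> y) *\<^sub>R e)"
        by (simp add: g_def z_def inner_add_right ee scaleR_add_left)
      also have "norm \<dots> \<le> \<bar>s + e \<bullet> y\<bar> / \<alpha> + norm (y - (e \<bullet> y) *\<^sub>R e) / \<beta>"
        using norm_triangle_ineq e \<alpha> \<beta> by (fastforce intro: order_trans[OF norm_triangle_ineq])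
      also have "\<dots> \<le> (5/8 * \<alpha>) / \<alpha> + (r/8) / \<beta>"
      proof (intro add_mono divide_right_mono)
        show "\<bar>s + e \<bullet> y\<bar> \<le> 5/8 * \<alpha>"
          using s ex[of y] y \<alpha> by linarith
        show "norm (y - (e \<bullet> y) *\<^sub>R e) \<le> r / 8"
          using proj[of y] y by simp
      qed (use \<alpha> \<beta> in auto)
      also have "\<dots> < 1"
        using \<alpha> r by (simp add: \<beta>_def)
      finally have "g z \<in> ball 0 1"
        by simp
      then have "\<alpha> *\<^sub>R e + f (g z) \<in> F"
        unfolding F_eq by blast
      also have "\<alpha> *\<^sub>R e + f (g z) = real j *\<^sub>R (r / 4) *\<^sub>R e + x"
        by (simp add: fg z_def y_def s_def)
      finally show "real j *\<^sub>R (r / 4) *\<^sub>R e + x \<in> F" .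
    qed (use \<open>F \<in> lmeasurable\<close> in auto)
    with F_le have "real N * measure lebesgue (ball (\<alpha> *\<^sub>R e) (r / 8)) \<le> measure lebesgue (ball (0 :: real^'n) r)"
      by simp
    \<comment> \<open>Shrinking the radius by 8 divides the volume by
      \<open>8 ^ CARD('n)\<close>.\<close>
    then have "real N \<le> 8 ^ CARD('n)"
      using r content_ball_pos[of r "0 :: real^'n"] by (simp add: content_ball power_divide field_simps zero_less_mult_iff)
    with N(2) have "R / (2 * r) \<le> 8 ^ CARD('n)"
      by linarith
    then show ?thesis
      using r by (simp add: R_def field_simps)
  qed
qed

section \<open>Depth forces an inscribed ball\<close>

lemma halfspace_depth_le:
  assumes "norm v = 1"
  shows "halfspace_depth K q \<le> measure lebesgue {z\<in>K. v \<bullet> (z - q) \<ge> 0} / measure lebesgue K"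
  unfolding halfspace_depth_def
proof (rule cINF_lower)
  show "bdd_below ((\<lambda>v. measure lebesgue {z\<in>K. v \<bullet> (z - q) \<ge> 0} / measure lebesgue K) ` {v. norm v = 1})"
    by (rule bdd_belowI2[of _ 0]) simp
  show "v \<in> {v. norm v = 1}"
    using assms by simp
qed

text \<open>The cap of \<open>K\<close> beyond \<open>q\<close> in direction \<open>v\<close> lies
  in a slab of thickness \<open>w\<close>, and its volume bounds the depth from above.\<close>

lemma halfspace_depth_le_width:
  fixes K :: "(real^'n) set"
  assumes K: "bounded K" "open K" "K \<subseteq> cball 0 M" "0 < measure lebesgue K"
    and v: "norm v = 1" and w: "\<And>z. z \<in> K \<Longrightarrow> v \<bullet> z \<le> v \<bullet> q + w" and pos: "0 < M" "0 < w"
  shows "M * (halfspace_depth K q * measure lebesgue K) \<le> 2 * w * (4 * M) ^ CARD('n)"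
proof -
  define C where "C = {z\<in>K. v \<bullet> (z - q) \<ge> 0}"
  have "halfspace_depth K q * measure lebesgue K \<le> measure lebesgue C"
    using halfspace_depth_le[OF v, of K q] K by (simp add: C_def field_simps)
  then have "M * (halfspace_depth K q * measure lebesgue K) \<le> M * measure lebesgue C"
    using pos by simp
  also have "\<dots> \<le> 2 * w * (4 * M) ^ CARD('n)"
  proof (rule measure_slab_le[where c = "v \<bullet> q" and v = v])
    show "C \<in> lmeasurable"
      unfolding C_def using K by (intro lmeasurable_cap)
  qed (use K v w pos in \<open>auto simp: C_def inner_diff_right\<close>)
  finally show ?thesis .
qed

text \<open>A missing point \<open>y\<close> of the ball would be separated from \<open>K\<close> by
  a hyperplane, leaving \<open>K\<close> too little width beyond \<open>q\<close> for the depth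
  \<open>\<delta>\<close>.\<close>

lemma ball_subset_if_halfspace_depth_ge:
  fixes K :: "(real^'n) set"
  assumes K: "convex K" "bounded K" "open K" "K \<subseteq> cball 0 M" "0 < measure lebesgue K" and M: "0 < M"
    and \<delta>: "0 < \<delta>" "\<delta> \<le> halfspace_depth K q"
  shows "ball q (M * (\<delta> * measure lebesgue K) / (2 * (4 * M) ^ CARD('n))) \<subseteq> K"
proof
  define \<eta> where "\<eta> = M * (\<delta> * measure lebesgue K) / (2 * (4 * M) ^ CARD('n))"
  fix y assume "y \<in> ball q (M * (\<delta> * measure lebesgue K) / (2 * (4 * M) ^ CARD('n)))"
  then have y: "norm (y - q) < \<eta>"
    by (simp add: \<eta>_def dist_norm norm_minus_commute)
  show "y \<in> K"
  proof (rule ccontr)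
    assume "y \<notin> K"
    have "K \<noteq> {}"
      using K(5) by auto
    with \<open>y \<notin> K\<close> obtain a b where a: "a \<noteq> 0" "a \<bullet> y \<ge> b" "\<And>z. z \<in> K \<Longrightarrow> a \<bullet> z \<le> b"
      using separating_hyperplane_sets[of K "{y}"] K by auto
    define v where "v = a /\<^sub>R norm a"
    have v: "norm v = 1"
      using a by (simp add: v_def)
    \<comment> \<open>The midpoint is positive even if \<open>y = q\<close>, and still strictly
      below \<open>\<eta>\<close>.\<close>
    define w where "w = (norm (y - q) + \<eta>) / 2"
    have w: "norm (y - q) \<le> w" "w < \<eta>" "0 < w"
      using y by (auto simp: w_def intro: add_nonneg_pos le_less_trans[OF norm_ge_zero])
    have width: "v \<bullet> z \<le> v \<bullet> q + w" if "z \<in> K" for z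
    proof -
      have "a \<bullet> z \<le> a \<bullet> y"
        using a(2) a(3)[OF that] by simp
      then have "v \<bullet> z \<le> v \<bullet> y"
        using a(1) by (auto simp: v_def intro!: mult_left_mono)
      moreover have "v \<bullet> (y - q) \<le> norm (y - q)"
        using norm_cauchy_schwarz[of v "y - q"] v by simp
      ultimately show ?thesis
        using w by (simp add: inner_diff_right)
    qed
    have "M * (\<delta> * measure lebesgue K) \<le> M * (halfspace_depth K q * measure lebesgue K)"
      using \<delta> M by (intro mult_left_mono mult_right_mono) auto
    also have "\<dots> \<le> 2 * w * (4 * M) ^ CARD('n)"
      using halfspace_depth_le_width[OF K(2-5) v width] M w by auto
    also have "\<dots> < 2 * \<eta> * (4 * M) ^ CARD('n)"
      using w M by (intro mult_strict_right_mono) auto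
    finally show False
      using M by (simp add: \<eta>_def)
  qed
qed

section \<open>Chords and the Hilbert metric\<close>

text \<open>Justifies the definite description: the ray from \<open>p\<close> away from
  \<open>q\<close> must leave the bounded set \<open>K\<close>, and by convexity it meets the
  frontier only once.\<close>

lemma chord_end:
  fixes K :: "(real^'n) set"
  assumes K: "convex K" "bounded K" "open K" and pq: "p \<in> K" "q \<in> K" "p \<noteq> q"
  shows "chord_end K p q \<in> frontier K" "p \<in> open_segment (chord_end K p q) q"
proof -
  have "\<exists>!a. a \<in> frontier K \<and> p \<in> open_segment a q"
  proof (rule ex_ex1I)
    obtain s where s: "0 < s" "p + s *\<^sub>R (p - q) \<in> frontier K"
      using ray_to_frontier[of K p "p - q"] K pq by (auto simp: interior_open)
    have "p \<in> open_segment (p + s *\<^sub>R (p - q)) q"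
      unfolding in_segment
    proof (intro conjI exI)
      show "p + s *\<^sub>R (p - q) \<noteq> q"
      proof
        assume "p + s *\<^sub>R (p - q) = q"
        then have "(1 + s) *\<^sub>R (p - q) = 0"
          by (simp add: algebra_simps)
        then show False using s pq by simp
      qed
      show "0 < s / (1 + s)" "s / (1 + s) < 1"
        using s by auto
      have "(1 + s) *\<^sub>R p = (1 + s) *\<^sub>R ((1 - s / (1 + s)) *\<^sub>R (p + s *\<^sub>R (p - q)) + (s / (1 + s)) *\<^sub>R q)"
        using s by (simp add: scaleR_add_right field_simps)
      then show "p = (1 - s / (1 + s)) *\<^sub>R (p + s *\<^sub>R (p - q)) + (s / (1 + s)) *\<^sub>R q"
        using s unfolding scaleR_cancel_left by linarith
    qed
    with s show "\<exists>a. a \<in> frontier K \<and> p \<in> open_segment a q"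
      by blast
  next
    fix a a' assume a: "a \<in> frontier K \<and> p \<in> open_segment a q" "a' \<in> frontier K \<and> p \<in> open_segment a' q"
    \<comment> \<open>Every candidate lies on this ray, so two candidates can be compared by their
      parameters.\<close>
    have on_ray: "\<exists>s>0. x = p + s *\<^sub>R (p - q)" if "p \<in> open_segment x q" for x
    proof -
      from that have "\<exists>u. 0 < u \<and> u < 1 \<and> p = (1 - u) *\<^sub>R x + u *\<^sub>R q"
        unfolding in_segment by (rule conjunct2)
      then obtain u where u: "0 < u" "u < 1" "p = (1 - u) *\<^sub>R x + u *\<^sub>R q"
        by metis
      have "(1 - u) *\<^sub>R x = p - u *\<^sub>R q"
        using u(3) by simp
      also have "\<dots> = (1 - u) *\<^sub>R p + u *\<^sub>R (p - q)"
        by (simp add: algebra_simps)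
      also have "\<dots> = (1 - u) *\<^sub>R (p + (u / (1 - u)) *\<^sub>R (p - q))"
        using u(1,2) by (simp add: scaleR_add_right)
      finally have "x = p + (u / (1 - u)) *\<^sub>R (p - q)"
        using u(2) unfolding scaleR_cancel_left by linarith
      then show ?thesis using u by (intro exI[of _ "u / (1 - u)"]) auto
    qed
    \<comment> \<open>The nearer of two frontier points would lie strictly between the interior
      point \<open>p\<close> and a point of the closure, hence in the interior.\<close>
    have not_less: "\<not> s < s'" if "0 < s" "p + s *\<^sub>R (p - q) \<in> frontier K" "p + s' *\<^sub>R (p - q) \<in> frontier K" for s s'
    proof
      assume "s < s'"
      have "p + s *\<^sub>R (p - q) \<in> open_segment p (p + s' *\<^sub>R (p - q))"
        unfolding in_segment using that \<open>s < s'\<close> pq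
        by (auto intro!: exI[of _ "s / s'"] simp: algebra_simps)
      moreover have "open_segment p (p + s' *\<^sub>R (p - q)) \<subseteq> interior K"
        using K pq that by (intro in_interior_closure_convex_segment)
          (auto simp: interior_open frontier_def)
      ultimately show False
        using that by (auto simp: frontier_def)
    qed
    show "a = a'"
      using a on_ray not_less by (metis linorder_neqE_linordered_idom)
  qed
  from theI'[OF this] show "chord_end K p q \<in> frontier K" "p \<in> open_segment (chord_end K p q) q"
    by (auto simp: chord_end_def)
qed

text \<open>Chord ends lie outside the open set \<open>K\<close>, so the inscribed balls bound the
  denominator of the cross ratio from below; both factors of the numerator are at most the diameter
  \<open>2 * M\<close>.\<close>

lemma hilbert_dist_le:
  fixes K :: "(real^'n) set"
  assumes K: "convex K" "bounded K" "open K" "K \<subseteq> cball 0 M"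
    and p: "0 < \<rho>" "ball p \<rho> \<subseteq> K" and q: "0 < \<sigma>" "ball q \<sigma> \<subseteq> K" and ne: "p \<noteq> q"
  shows "hilbert_dist K p q \<le> 1/2 * ln ((2 * M)\<^sup>2 / (\<rho> * \<sigma>))"
proof -
  have pqK: "p \<in> K" "q \<in> K"
    using p q by auto
  have pq_norm: "norm p \<le> M" "norm q \<le> M"
    using pqK K(4) by auto
  define a b where "a = chord_end K p q" and "b = chord_end K q p"
  have ab: "a \<in> frontier K" "b \<in> frontier K"
    using chord_end[OF K(1-3)] pqK ne by (auto simp: a_def b_def)
  then have ab_notin: "a \<notin> K" "b \<notin> K"
    using K(3) by (auto simp: frontier_def interior_open)
  have "closure K \<subseteq> cball 0 M"
    using K(4) by (intro closure_minimal) auto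
  then have ab_norm: "norm a \<le> M" "norm b \<le> M"
    using ab by (auto simp: frontier_def)
  have lower: "\<rho> \<le> norm (p - a)" "\<sigma> \<le> norm (q - b)"
    using ab_notin p q by (auto simp: dist_norm subset_iff not_less[symmetric])
  have upper: "norm (q - a) \<le> 2 * M" "norm (p - b) \<le> 2 * M"
    using norm_triangle_ineq4[of q a] norm_triangle_ineq4[of p b] ab_norm pq_norm by auto
  have pos: "0 < norm (q - a)" "0 < norm (p - b)"
    using ab_notin pqK by auto
  have "0 < M"
    using upper pos by linarith
  have "norm (q - a) * norm (p - b) / (norm (p - a) * norm (q - b)) \<le> (2 * M) * (2 * M) / (\<rho> * \<sigma>)"
    using lower upper pos p q \<open>0 < M\<close> by (intro frac_le mult_mono) auto
  then have "ln (norm (q - a) * norm (p - b) / (norm (p - a) * norm (q - b))) \<le> ln ((2 * M)\<^sup>2 / (\<rho> * \<sigma>))"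
    using lower pos p(1) q(1) \<open>0 < M\<close> by (subst ln_le_cancel_iff) (auto simp: power2_eq_square intro!: divide_pos_pos mult_pos_pos)
  then show ?thesis
    using ne by (simp add: hilbert_dist_def Let_def flip: a_def b_def)
qed

section \<open>Depth of the origin and explicit bounds in canonical form\<close>

text \<open>A halfspace through the centre of a ball contained in \<open>K\<close> cuts off at least half of that ball.\<close>

lemma halfspace_depth_centre_ge:
  fixes K :: "(real^'n) set"
  assumes K: "bounded K" "open K" and r: "ball 0 r \<subseteq> K"
  shows "measure lebesgue (ball (0 :: real^'n) r) / (2 * measure lebesgue K) \<le> halfspace_depth K 0"
  unfolding halfspace_depth_def
proof (rule cINF_greatest)
  show "{v :: real^'n. norm v = 1} \<noteq> {}"
    using vector_choose_size[of 1] by auto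
next
  fix v :: "real^'n"
  define H H' where "H = {z\<in>ball 0 r. v \<bullet> (z - 0) \<ge> 0}" and "H' = {z\<in>ball 0 r. (- v) \<bullet> (z - 0) \<ge> 0}"
  have H: "H \<in> lmeasurable" "H' \<in> lmeasurable"
    unfolding H_def H'_def by (rule lmeasurable_cap; auto)+
  \<comment> \<open>Reflection in the origin exchanges the two half balls, so they have equal
    volume.\<close>
  have "H' = (\<lambda>x. 0 + (- 1) *\<^sub>R x) ` H"
  proof (intro equalityI subsetI)
    fix z assume "z \<in> H'"
    then show "z \<in> (\<lambda>x. 0 + (- 1) *\<^sub>R x) ` H"
      by (intro image_eqI[of _ _ "- z"]) (auto simp: H_def H'_def)
  qed (auto simp: H_def H'_def)
  then have H': "measure lebesgue H' = measure lebesgue H"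
    using measure_lebesgue_affine[of "- 1" 0 H] by simp
  have "ball 0 r \<subseteq> H \<union> H'"
    by (auto simp: H_def H'_def)
  then have "measure lebesgue (ball (0 :: real^'n) r) \<le> measure lebesgue (H \<union> H')"
    using H by (intro measure_mono_fmeasurable) auto
  also have "\<dots> \<le> 2 * measure lebesgue H"
    using measure_Un_le[of H lebesgue H'] H H' by auto
  also have "measure lebesgue H \<le> measure lebesgue {z\<in>K. v \<bullet> (z - 0) \<ge> 0}"
    using H lmeasurable_cap[OF K, of v 0] r by (intro measure_mono_fmeasurable) (auto simp: H_def)
  finally have "measure lebesgue (ball (0 :: real^'n) r) / 2 / measure lebesgue K \<le> measure lebesgue {z\<in>K. v \<bullet> (z - 0) \<ge> 0} / measure lebesgue K"
    by (intro divide_right_mono) auto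
  then show "measure lebesgue (ball (0 :: real^'n) r) / (2 * measure lebesgue K)
      \<le> measure lebesgue {z\<in>K. v \<bullet> (z - 0) \<ge> 0} / measure lebesgue K"
    by simp
qed

lemma canonical_form_subset_cball:
  fixes K :: "(real^'n) set"
  assumes "open_convex_body K" "canonical_form K"
  shows "K \<subseteq> cball 0 (8 ^ CARD('n))"
proof -
  have "K \<subseteq> cball 0 (2 * 8 ^ CARD('n) * (1 / (2 * real CARD('n))))"
    using assms by (intro inner_John_ball_subset_cball) (auto simp: open_convex_body_def canonical_form_def)
  also have "\<dots> \<subseteq> cball 0 (8 ^ CARD('n))"
    by (intro subset_cball) (simp add: field_simps)
  finally show ?thesis .
qed

lemma canonical_form_ball_subset:
  fixes K :: "(real^'n) set"
  assumes "canonical_form K"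
  shows "ball 0 (1 / (2 * real CARD('n))) \<subseteq> K"
  using assms by (simp add: canonical_form_def inner_John_ellipsoid_def)

lemma double_le_two_power:
  assumes "1 \<le> n"
  shows "2 * n \<le> (2 :: nat) ^ n"
  using assms by (induction n rule: dec_induct) auto

lemma lmeasurable_body:
  fixes K :: "(real^'n) set"
  assumes "open_convex_body K"
  shows "K \<in> lmeasurable"
  using assms by (auto simp: open_convex_body_def intro: lmeasurable_open)

text \<open>The inscribed ball contains a cube of side \<open>1 / d\<^sup>2\<close>, and
  \<open>d\<^sup>2 \<le> 4 ^ d\<close>.\<close>

lemma measure_canonical_ge:
  fixes K :: "(real^'n) set"
  assumes K: "open_convex_body K" "canonical_form K"
  shows "1 / 2 ^ (2 * CARD('n)\<^sup>2) \<le> measure lebesgue K"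
proof -
  define d where "d = CARD('n)"
  have d: "1 \<le> d" by (simp add: d_def Suc_leI)
  have "real d * d \<le> 2 ^ d * 2 ^ d"
    by (intro mult_mono) (auto intro: less_imp_le)
  then have "(1 / (2 ^ d * 2 ^ d)) ^ d \<le> (2 * (1 / (2 * real d) / real d)) ^ d"
    using d by (intro power_mono) (auto simp: field_simps)
  also have "\<dots> \<le> measure lebesgue (ball (0 :: real^'n) (1 / (2 * real d)))"
    using measure_ball_ge[of "1 / (2 * real d)", where ?'n = 'n] d by (simp add: d_def)
  also have "\<dots> \<le> measure lebesgue K"
    using lmeasurable_body[OF K(1)] canonical_form_ball_subset[OF K(2)]
    by (intro measure_mono_fmeasurable) (auto simp: d_def)
  finally show ?thesis
    by (simp add: power_divide power2_eq_square mult_2 power_add power_mult power_mult_distrib flip: d_def)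
qed

lemma measure_canonical_pos:
  fixes K :: "(real^'n) set"
  assumes K: "open_convex_body K" "canonical_form K"
  shows "0 < measure lebesgue K"
  by (rule less_le_trans[OF _ measure_canonical_ge[OF K]]) simp

text \<open>Compares half the inscribed ball with the outer ball of radius \<open>8 ^ d\<close>; the
  volume \<open>u\<close> of the unit ball cancels.\<close>

lemma halfspace_depth_origin_ge:
  fixes K :: "(real^'n) set"
  assumes K: "open_convex_body K" "canonical_form K"
  shows "1 / 2 ^ (5 * CARD('n)\<^sup>2) \<le> halfspace_depth K 0"
proof -
  define d where "d = CARD('n)"
  define u where "u = measure lebesgue (ball (0 :: real^'n) 1)"
  have d: "1 \<le> d" by (simp add: d_def Suc_leI)
  have u: "0 < u"
    using content_ball_pos[of 1 "0 :: real^'n"] by (simp add: u_def)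
  note K0 = measure_canonical_pos[OF K]
  have "measure lebesgue K \<le> measure lebesgue (cball (0 :: real^'n) (8 ^ d))"
    using lmeasurable_body[OF K(1)] canonical_form_subset_cball[OF K]
    by (intro measure_mono_fmeasurable) (auto simp: d_def)
  also have "\<dots> = (8 ^ d) ^ d * u"
    by (simp add: u_def content_cball content_ball d_def)
  finally have upper: "measure lebesgue K \<le> (8 ^ d) ^ d * u" .
  have ball: "measure lebesgue (ball (0 :: real^'n) (1 / (2 * real d))) = (1 / (2 * real d)) ^ d * u"
    using content_ball_conv_unit_ball[of "1 / (2 * real d)" "0 :: real^'n"] by (simp add: u_def d_def)
  have "real (2 * d) \<le> real (2 ^ d)"
    using double_le_two_power[OF d] by (subst of_nat_le_iff)
  then have lower: "(1 / 2 ^ d) ^ d \<le> (1 / (2 * real d)) ^ d"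
    using d by (intro power_mono) (auto simp: field_simps)
  have d2: "1 \<le> d\<^sup>2"
    using d by simp
  have "(8 :: real) ^ d = 2 ^ (3 * d)"
    by (simp add: power_mult)
  then have pows: "(2 ^ d) ^ d = (2 :: real) ^ d\<^sup>2" "(8 ^ d) ^ d = (2 :: real) ^ (3 * d\<^sup>2)"
    by (simp_all flip: power_mult add: power2_eq_square mult.assoc)
  \<comment> \<open>The exponent collects 1 from halving the ball, \<open>d\<^sup>2\<close> from
    \<open>2 * d \<le> 2 ^ d\<close> for the inner radius, and \<open>3 * d\<^sup>2\<close> from the
    outer radius.\<close>
  have "(2 :: real) ^ (1 + 4 * d\<^sup>2) \<le> 2 ^ (5 * d\<^sup>2)"
    using d2 by (intro power_increasing) linarith+
  then have "1 / 2 ^ (5 * d\<^sup>2) \<le> 1 / (2 :: real) ^ (1 + 4 * d\<^sup>2)"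
    by (intro divide_left_mono) auto
  also have "(2 :: real) ^ (1 + 4 * d\<^sup>2) = 2 ^ d\<^sup>2 * (2 * 2 ^ (3 * d\<^sup>2))"
    by (simp flip: power_add)
  also have "1 / \<dots> = ((1 / 2 ^ d) ^ d * u) / (2 * ((8 ^ d) ^ d * u))"
    using u by (simp add: power_divide pows)
  also have "\<dots> \<le> ((1 / (2 * real d)) ^ d * u) / (2 * measure lebesgue K)"
    using upper u K0 lower by (intro frac_le mult_right_mono) auto
  also have "\<dots> \<le> halfspace_depth K 0"
    using halfspace_depth_centre_ge[of K "1 / (2 * real d)"] canonical_form_ball_subset[OF K(2)] K(1) ball
    by (simp add: open_convex_body_def flip: d_def)
  finally show ?thesis by (simp add: d_def)
qed

lemma trimmed_region_ball_subset:
  fixes K :: "(real^'n) set"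
  assumes K: "open_convex_body K" "canonical_form K" and \<delta>: "0 < \<delta>" and q: "q \<in> trimmed_region K \<delta>"
  shows "ball q (\<delta> / 2 ^ (8 * CARD('n)\<^sup>2)) \<subseteq> K"
proof -
  define d where "d = CARD('n)"
  have d: "1 \<le> d" by (simp add: d_def Suc_leI)
  have dd: "d \<le> d\<^sup>2" "1 \<le> d\<^sup>2"
    using d by (auto simp: power2_eq_square)
  have "(4 * 8 ^ d :: real) = 2 ^ (3 * d + 2)"
    by (simp add: power_mult)
  then have "(4 * 8 ^ d :: real) ^ d = 2 ^ ((3 * d + 2) * d)"
    by (simp only: power_mult)
  also have "(3 * d + 2) * d = 3 * d\<^sup>2 + 2 * d"
    by (simp add: power2_eq_square algebra_simps)
  finally have pow: "2 * (4 * 8 ^ d :: real) ^ d = 2 ^ (3 * d\<^sup>2 + 2 * d + 1)"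
    by simp
  have split: "\<delta> / 2 ^ (a + b) = 1 * (\<delta> * (1 / 2 ^ a)) / 2 ^ b" for a b
    by (simp add: power_add)
  \<comment> \<open>The exponent \<open>2 * d\<^sup>2\<close> comes from the lower volume bound, the
    remainder from \<open>pow\<close>; the leading factor \<open>M = 8 ^ d\<close> is estimated
    below by 1.\<close>
  have "\<delta> / 2 ^ (8 * d\<^sup>2) \<le> \<delta> / 2 ^ (2 * d\<^sup>2 + (3 * d\<^sup>2 + 2 * d + 1))"
    using \<delta> dd by (intro divide_left_mono power_increasing) auto
  also have "\<dots> = 1 * (\<delta> * (1 / 2 ^ (2 * d\<^sup>2))) / (2 * (4 * 8 ^ d) ^ d)"
    unfolding pow by (rule split)
  also have "\<dots> \<le> 8 ^ d * (\<delta> * measure lebesgue K) / (2 * (4 * 8 ^ d) ^ d)"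
    using measure_canonical_ge[OF K] \<delta> by (intro divide_right_mono mult_mono mult_left_mono) (auto simp: d_def)
  finally have "ball q (\<delta> / 2 ^ (8 * d\<^sup>2)) \<subseteq> ball q (8 ^ d * (\<delta> * measure lebesgue K) / (2 * (4 * 8 ^ d) ^ d))"
    by (rule subset_ball)
  also have "\<dots> \<subseteq> K"
    using ball_subset_if_halfspace_depth_ge[of K "8 ^ d" \<delta> q] canonical_form_subset_cball[OF K]
      measure_canonical_pos[OF K] K(1) \<delta> q
    by (auto simp: open_convex_body_def trimmed_region_def d_def)
  finally show ?thesis by (simp add: d_def)
qed

section \<open>Assembling the Hilbert radius\<close>

text \<open>Any \<open>x\<close> with this much room in \<open>K\<close> can serve as centre: only
  the inscribed radius at \<open>q\<close> depends on \<open>\<delta>\<close>, and it does so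
  linearly, which gives \<open>1/2 * ln (1/\<delta>)\<close>. The other factors are powers of 2 with
  exponent quadratic in \<open>d\<close>.\<close>

lemma trimmed_region_subset_hilbert_ball:
  fixes K :: "(real^'n) set"
  assumes K: "open_convex_body K" "canonical_form K" and \<delta>: "0 < \<delta>" "\<delta> \<le> 1/2"
    and x: "ball x (1 / 2 ^ (13 * CARD('n)\<^sup>2)) \<subseteq> K"
  shows "trimmed_region K \<delta> \<subseteq> hilbert_ball K x (1/2 * ln (1/\<delta>) + 24 * real CARD('n) ^ 3)"
proof
  define d where "d = CARD('n)"
  have d: "1 \<le> d" by (simp add: d_def Suc_leI)
  have dd: "d \<le> d\<^sup>2"
    using d by (simp add: power2_eq_square)
  fix q assume q: "q \<in> trimmed_region K \<delta>"
  note ball_q = trimmed_region_ball_subset[OF K \<delta>(1) q]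
  have ln_pow: "ln (2 ^ k * (1 / \<delta>)) = real k * ln 2 + ln (1 / \<delta>)" for k
    using \<delta> by (subst ln_mult_pos) (auto simp: ln_realpow)
  have "0 \<le> ln (1 / \<delta>)"
    using \<delta> by simp
  have "hilbert_dist K x q < 1/2 * ln (1/\<delta>) + 24 * real d ^ 3"
  proof (cases "x = q")
    case True
    have "0 < 24 * real d ^ 3"
      using d by simp
    then have "0 < 1/2 * ln (1 / \<delta>) + 24 * real d ^ 3"
      using \<open>0 \<le> ln (1 / \<delta>)\<close> by linarith
    with True show ?thesis
      by (simp add: hilbert_dist_def)
  next
    case False
    have "hilbert_dist K x q \<le> 1/2 * ln ((2 * 8 ^ d)\<^sup>2 / (1 / 2 ^ (13 * d\<^sup>2) * (\<delta> / 2 ^ (8 * d\<^sup>2))))"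
      using hilbert_dist_le[OF _ _ _ canonical_form_subset_cball[OF K] _ x _ ball_q False] K(1) \<delta>
      by (auto simp: open_convex_body_def d_def)
    also have "(2 * 8 ^ d)\<^sup>2 / (1 / 2 ^ (13 * d\<^sup>2) * (\<delta> / 2 ^ (8 * d\<^sup>2))) = 2 ^ (6 * d + 2 + 21 * d\<^sup>2) * (1 / \<delta>)"
    proof -
      have "(8 :: real) ^ d = 2 ^ (3 * d)"
        by (simp add: power_mult)
      then have "(2 * 8 ^ d :: real)\<^sup>2 = 2 ^ (6 * d + 2)"
        by (simp add: power_mult_distrib power_add flip: power_mult)
      moreover have "(2 :: real) ^ (21 * d\<^sup>2) = 2 ^ (13 * d\<^sup>2) * 2 ^ (8 * d\<^sup>2)"
        by (simp flip: power_add)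
      ultimately show ?thesis
        by (simp add: power_add)
    qed
    also have "ln (2 ^ (6 * d + 2 + 21 * d\<^sup>2) * (1 / \<delta>)) = real (6 * d + 2 + 21 * d\<^sup>2) * ln 2 + ln (1 / \<delta>)"
      by (rule ln_pow)
    also have "\<dots> \<le> real (29 * d\<^sup>2) * 1 + ln (1 / \<delta>)"
    proof -
      \<comment> \<open>Here \<open>21 = 13 + 8\<close> comes from the two inscribed radii and
        \<open>6 * d + 2\<close> from the squared diameter. Half of 29 is below 24.\<close>
      have "6 * d + 2 + 21 * d\<^sup>2 \<le> 29 * d\<^sup>2"
        using d dd by linarith
      then show ?thesis
        using ln_2_less_1 by (intro add_right_mono mult_mono of_nat_mono) auto
    qed
    finally have "hilbert_dist K x q \<le> 29 / 2 * real d ^ 2 + 1/2 * ln (1 / \<delta>)"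
      by simp
    also have "real d ^ 2 \<le> real d ^ 3"
      using d by (intro power_increasing) auto
    also have "29 / 2 * real d ^ 3 + 1/2 * ln (1 / \<delta>) < 1/2 * ln (1/\<delta>) + 24 * real d ^ 3"
      using d by simp
    finally show ?thesis by simp
  qed
  moreover have "q \<in> K"
    using ball_q \<delta> by (auto simp: subset_iff)
  ultimately show "q \<in> hilbert_ball K x (1/2 * ln (1/\<delta>) + 24 * real CARD('n) ^ 3)"
    by (simp add: hilbert_ball_def d_def)
qed

theorem corollary2p9:
  fixes K :: "(real^'n) set" and \<delta> :: real
  assumes "open_convex_body K"
    and "canonical_form K"
    and "0 < \<delta>" and "\<delta> \<le> 1/2"
    and "trimmed_region K \<delta> \<noteq> {}"
  shows "(\<exists>x\<in>trimmed_region K \<delta>.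
            trimmed_region K \<delta> \<subseteq> hilbert_ball K x (1/2 * ln (1/\<delta>) + 24 * real CARD('n) ^ 3)) \<and>
         (0 \<in> trimmed_region K \<delta> \<longrightarrow>
            trimmed_region K \<delta> \<subseteq> hilbert_ball K 0 (1/2 * ln (1/\<delta>) + 24 * real CARD('n) ^ 3)) \<and>
         (0 \<notin> trimmed_region K \<delta> \<longrightarrow> (\<forall>x\<in>trimmed_region K \<delta>.
            trimmed_region K \<delta> \<subseteq> hilbert_ball K x (1/2 * ln (1/\<delta>) + 24 * real CARD('n) ^ 3)))"
proof -
  note K = assms(1,2) and \<delta> = assms(3,4)
  define d where "d = CARD('n)"
  have d: "1 \<le> d" by (simp add: d_def Suc_leI)
  \<comment> \<open>The inner ball of the canonical form has enough room for the origin to be a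
    centre.\<close>
  have "2 * real d \<le> 2 ^ d"
    using double_le_two_power[OF d] by (metis of_nat_le_iff of_nat_mult of_nat_numeral of_nat_power)
  also have "\<dots> \<le> 2 ^ (13 * d\<^sup>2)"
    using d by (intro power_increasing) (auto simp: power2_eq_square)
  finally have "ball 0 (1 / 2 ^ (13 * d\<^sup>2)) \<subseteq> ball (0 :: real^'n) (1 / (2 * real d))"
    using d by (intro subset_ball frac_le) auto
  also have "\<dots> \<subseteq> K"
    using canonical_form_ball_subset[OF K(2)] by (simp add: d_def)
  finally have origin: "trimmed_region K \<delta> \<subseteq> hilbert_ball K 0 (1/2 * ln (1/\<delta>) + 24 * real CARD('n) ^ 3)"
    using trimmed_region_subset_hilbert_ball[OF K \<delta>] by (simp add: d_def)
  have other: "trimmed_region K \<delta> \<subseteq> hilbert_ball K x (1/2 * ln (1/\<delta>) + 24 * real CARD('n) ^ 3)"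
    if "0 \<notin> trimmed_region K \<delta>" "x \<in> trimmed_region K \<delta>" for x
  proof (rule trimmed_region_subset_hilbert_ball[OF K \<delta>])
    \<comment> \<open>If the origin is not in the region, \<open>\<delta>\<close> exceeds its depth.
      Combined with the inscribed radius \<open>\<delta> / 2 ^ (8 * d\<^sup>2)\<close> at
      \<open>x\<close>, this explains the exponent \<open>13 = 5 + 8\<close>.\<close>
    have "1 / 2 ^ (5 * d\<^sup>2) \<le> \<delta>"
      using halfspace_depth_origin_ge[OF K] that(1) by (simp add: trimmed_region_def d_def)
    then have "1 / 2 ^ (5 * d\<^sup>2) / 2 ^ (8 * d\<^sup>2) \<le> \<delta> / 2 ^ (8 * d\<^sup>2)"
      by (intro divide_right_mono) auto
    then have "1 / 2 ^ (13 * d\<^sup>2) \<le> \<delta> / 2 ^ (8 * d\<^sup>2)"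
      by (simp flip: power_add)
    then have "ball x (1 / 2 ^ (13 * d\<^sup>2)) \<subseteq> ball x (\<delta> / 2 ^ (8 * d\<^sup>2))"
      by (rule subset_ball)
    with trimmed_region_ball_subset[OF K \<delta>(1) that(2)]
    show "ball x (1 / 2 ^ (13 * CARD('n)\<^sup>2)) \<subseteq> K"
      by (auto simp: d_def)
  qed
  from origin other assms(5) show ?thesis
    by blast
qed

end
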